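(* Consider a sequence of community detection problems with fixed expected total degree, indexed by $N\to\infty$, with parameters $n,p_0',p_1$ (depending on $N$) satisfying the standing assumptions of the context. Assume that $\liminf p_0N^2/n>1$. If $$\liminf \frac{n\,H_{p_0}(p_1)}{2\log(N/n)}>1 ,$$ then the scan test calibrated by estimation of $p_0$ is asymptotically powerful for fixed expected total degree: there is a sequence of levels $\alpha_N\in(0,1)$ such that the test $T_N$ which rejects ($T_N=1$) if and only if $\pi_N(W^*_{[n]},\hat p_0)\le\alpha_N$ satisfies $\gamma'_N(T_N)\to0$, where $W^*_{[n]}$, $\hat p_0$ and the estimated p-value $\pi_N$ are defined in the context.
   Context: Observed data: the adjacency matrix $\boldsymbol{W}=(W_{i,j})\in\{0,1\}^{N\times N}$ (symmetric, zero diagonal) of a random undirected graph on the node set $\{1,\dots,N\}$. Notation: $m^{(2)}=m(m-1)/2$; $\mathbb{G}(N,p)$ is the Erdős–Rényi random graph on $N$ nodes with connection probability $p$. Fixed expected total degree model: given $0<p_0'\le p_1<1$, set $p_0:=p_0'+(p_1-p_0')\frac{n^{(2)}}{N^{(2)}}$. Under $\mathbb{P}_0$ (null), the $W_{i,j}$, $i<j$, are i.i.d. Bernoulli$(p_0)$. For $S\subset\{1,\dots,N\}$ with $|S|=n$, under $\mathbb{P}'_S$ (alternative), the $W_{i,j}$, $i<j$, are independent, $\mathbb{P}'_S(W_{i,j}=1)=p_1$ if $i,j\in S$, and $=p_0'$ otherwise. A test $T$ is a function of $\boldsymbol{W}$ with values in $\{0,1\}$, and its risk is $\gamma'_N(T)=\mathbb{P}_0(T=1)+\max_{|S|=n}\mathbb{P}'_S(T=0)$.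 Scan statistic: $W^*_{[n]}=\max_{|S|=n}\sum_{i,j\in S,\ i<j}W_{i,j}$. Estimator: $\hat p_0=\frac1{N^{(2)}}\sum_{1\le i<j\le N}W_{i,j}$. For $x\in\mathbb{R}$ and $p\in[0,1]$, $\pi_N(x,p)$ is the probability that the scan statistic of a graph drawn from $\mathbb{G}(N,p)$ is at least $x$. Calibration by estimation of $p_0$ means comparing the observed scan statistic with its distribution under $\mathbb{G}(N,\hat p_0)$, i.e. rejecting when $\pi_N(W^*_{[n]},\hat p_0)$ is small. Entropy function: $H_p(q)=q\log\frac qp+(1-q)\log\frac{1-q}{1-p}$. Standing assumptions: $N\to\infty$; $n,p_0',p_1$ may depend on $N$; $n/N\to0$; $p_0$ is bounded away from $1$; $N^2p_0\to\infty$; and $n\to\infty$ with $n^2p_1\to\infty$. *)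

theory Defs
  imports "HOL-Probability.Probability"
begin

definition pairs2 :: "nat \<Rightarrow> real" where
  "pairs2 m = real m * (real m - 1) / 2"

definition upper_pairs :: "nat set \<Rightarrow> (nat \<times> nat) set" where
  "upper_pairs S = {(i, j). i \<in> S \<and> j \<in> S \<and> i < j}"

text \<open>
  An observation is an adjacency matrix \<open>W\<close>, with entries \<open>W i j\<close> in \<open>{0,1}\<close> and indices
  in \<open>{1..N}\<close>; entries outside this range are \<open>0\<close>.
\<close>

type_synonym adj_matrix = "nat \<Rightarrow> nat \<Rightarrow> nat"

definition adj_of_edges :: "nat \<Rightarrow> (nat \<times> nat \<Rightarrow> bool) \<Rightarrow> adj_matrix" where
  "adj_of_edges N e = (\<lambda>i j.
     if (i, j) \<in> upper_pairs {1..N} then of_bool (e (i, j))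
     else if (j, i) \<in> upper_pairs {1..N} then of_bool (e (j, i))
     else 0)"

text \<open>
  Law of the adjacency matrix when the entries with \<open>i < j\<close> are independent Bernoulli
  variables with success probabilities \<open>q i j\<close>.
\<close>

definition random_graph :: "nat \<Rightarrow> (nat \<Rightarrow> nat \<Rightarrow> real) \<Rightarrow> adj_matrix pmf" where
  "random_graph N q =
     map_pmf (adj_of_edges N)
       (Pi_pmf (upper_pairs {1..N}) False (\<lambda>(i, j). bernoulli_pmf (q i j)))"

definition erdos_renyi :: "nat \<Rightarrow> real \<Rightarrow> adj_matrix pmf" where
  "erdos_renyi N p = random_graph N (\<lambda>i j. p)"

definition null_prob :: "nat \<Rightarrow> nat \<Rightarrow> real \<Rightarrow> real \<Rightarrow> real" where
  "null_prob N n p0' p1 = p0' + (p1 - p0') * (pairs2 n / pairs2 N)"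

definition null_law :: "nat \<Rightarrow> nat \<Rightarrow> real \<Rightarrow> real \<Rightarrow> adj_matrix pmf" where
  "null_law N n p0' p1 = erdos_renyi N (null_prob N n p0' p1)"

definition alt_law :: "nat \<Rightarrow> nat set \<Rightarrow> real \<Rightarrow> real \<Rightarrow> adj_matrix pmf" where
  "alt_law N S p0' p1 = random_graph N (\<lambda>i j. if i \<in> S \<and> j \<in> S then p1 else p0')"

definition node_subsets :: "nat \<Rightarrow> nat \<Rightarrow> nat set set" where
  "node_subsets N n = {S. S \<subseteq> {1..N} \<and> card S = n}"

text \<open>A test takes the values \<open>0\<close> (accept) and \<open>1\<close> (reject).\<close>

definition risk :: "nat \<Rightarrow> nat \<Rightarrow> real \<Rightarrow> real \<Rightarrow> (adj_matrix \<Rightarrow> nat) \<Rightarrow> real" where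
  "risk N n p0' p1 T =
     measure_pmf.prob (null_law N n p0' p1) {W. T W = 1}
     + Max ((\<lambda>S. measure_pmf.prob (alt_law N S p0' p1) {W. T W = 0}) ` node_subsets N n)"

definition scan_stat :: "nat \<Rightarrow> nat \<Rightarrow> adj_matrix \<Rightarrow> nat" where
  "scan_stat N n W = Max ((\<lambda>S. \<Sum>(i, j)\<in>upper_pairs S. W i j) ` node_subsets N n)"

definition p0_hat :: "nat \<Rightarrow> adj_matrix \<Rightarrow> real" where
  "p0_hat N W = (1 / pairs2 N) * (\<Sum>(i, j)\<in>upper_pairs {1..N}. real (W i j))"

definition scan_pvalue :: "nat \<Rightarrow> nat \<Rightarrow> real \<Rightarrow> real \<Rightarrow> real" where
  "scan_pvalue N n x p = measure_pmf.prob (erdos_renyi N p) {W. real (scan_stat N n W) \<ge> x}"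

definition calibrated_scan_test :: "nat \<Rightarrow> nat \<Rightarrow> real \<Rightarrow> adj_matrix \<Rightarrow> nat" where
  "calibrated_scan_test N n \<alpha> W =
     (if scan_pvalue N n (real (scan_stat N n W)) (p0_hat N W) \<le> \<alpha> then 1 else 0)"

definition entropy_fun :: "real \<Rightarrow> real \<Rightarrow> real" where
  "entropy_fun p q = q * ln (q / p) + (1 - q) * ln ((1 - q) / (1 - p))"

end

theory Submission
  imports Defs
begin

text \<open>
  Size. A graph \<open>W\<close> has probability at most its probability under the density
  \<open>p0_hat N W\<close>, which maximises the likelihood. On the graphs with a given number of edges the
  estimated p-value is therefore controlled by the genuine p-value at a fixed parameter, and
  a union bound over the number of edges shows that the calibrated test has size at most
  \<open>\<alpha>\<close> times a quantity of order \<open>N\<^sup>2\<close>. The level \<open>\<alpha> = 1 / (N + 2)\<^sup>3\<close> suffices.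

  Power. By Chernoff's bound with the exponent that is optimal for \<open>(p0, p1)\<close>, the logarithm
  of the estimated p-value is, up to the union bound over node subsets, at most an affine
  function of the number of edges inside \<open>S\<close> and of \<open>p0_hat\<close>. Since the expected total
  degree is fixed, \<open>p0_hat\<close> is unbiased under the alternative, so this function has mean
  \<open>- pairs2 n * entropy_fun p0 p1\<close>. Its standard deviation is of smaller order, and Chebyshev's
  inequality applies.
\<close>

subsection \<open>Sums of independent Bernoulli variables\<close>

lemma finite_set_Pi_pmf:
  assumes "finite A" "\<And>x. x \<in> A \<Longrightarrow> finite (set_pmf (p x))"
  shows "finite (set_pmf (Pi_pmf A d p))"
  using finite_subset[OF set_Pi_pmf_subset'[OF assms(1)]] finite_PiE_dflt[OF assms(1)] assms(2)
  by (metis comp_apply)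

lemma expectation_Pi_pmf_component:
  fixes g :: "'b \<Rightarrow> real"
  assumes "finite A" "x \<in> A"
  shows "measure_pmf.expectation (Pi_pmf A d p) (\<lambda>f. g (f x)) = measure_pmf.expectation (p x) g"
proof -
  have "p x = map_pmf (\<lambda>f. f x) (Pi_pmf A d p)"
    using assms by (simp add: Pi_pmf_component)
  then show ?thesis
    by (metis integral_map_pmf)
qed

text \<open>Independence factorises every cross term and centring makes it vanish, so only the
  diagonal survives. Finite supports settle integrability.\<close>

lemma second_moment_sum_Pi_pmf:
  fixes g :: "'a \<Rightarrow> 'b \<Rightarrow> real"
  assumes A: "finite A" and fin: "\<And>x. x \<in> A \<Longrightarrow> finite (set_pmf (p x))"
    and zero: "\<And>x. x \<in> A \<Longrightarrow> measure_pmf.expectation (p x) (g x) = 0"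
  shows "measure_pmf.expectation (Pi_pmf A d p) (\<lambda>f. (\<Sum>x\<in>A. g x (f x))\<^sup>2)
         = (\<Sum>x\<in>A. measure_pmf.expectation (p x) (\<lambda>v. (g x v)\<^sup>2))"
proof -
  let ?P = "Pi_pmf A d p"
  have int: "integrable (measure_pmf ?P) h" for h :: "('a \<Rightarrow> 'b) \<Rightarrow> real"
    by (rule integrable_measure_pmf_finite) (rule finite_set_Pi_pmf[OF A fin])
  have cross: "measure_pmf.expectation ?P (\<lambda>f. g x (f x) * g y (f y)) = 0"
    if xy: "x \<in> A" "y \<in> A" "x \<noteq> y" for x y
  proof -
    have "prob_space.indep_vars (measure_pmf ?P) (\<lambda>_. borel) (\<lambda>z f. g z (f z)) A"
      by (rule prob_space.indep_vars_compose2[OF _ indep_vars_Pi_pmf[OF A]])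
        (auto simp: measure_pmf.prob_space_axioms)
    then have ind: "prob_space.indep_vars (measure_pmf ?P) (\<lambda>_. borel) (\<lambda>z f. g z (f z)) {x, y}"
      by (rule prob_space.indep_vars_subset[OF measure_pmf.prob_space_axioms]) (use xy in auto)
    have "measure_pmf.expectation ?P (\<lambda>f. \<Prod>z\<in>{x, y}. g z (f z))
        = (\<Prod>z\<in>{x, y}. measure_pmf.expectation ?P (\<lambda>f. g z (f z)))"
      by (rule prob_space.indep_vars_lebesgue_integral[OF measure_pmf.prob_space_axioms _ ind])
        (auto intro: int)
    then show ?thesis
      using xy zero by (simp add: expectation_Pi_pmf_component[OF A])
  qed
  have "measure_pmf.expectation ?P (\<lambda>f. (\<Sum>x\<in>A. g x (f x))\<^sup>2)
      = measure_pmf.expectation ?P (\<lambda>f. \<Sum>x\<in>A. \<Sum>y\<in>A. g x (f x) * g y (f y))"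
    by (simp add: power2_eq_square sum_product)
  also have "\<dots> = (\<Sum>x\<in>A. \<Sum>y\<in>A. measure_pmf.expectation ?P (\<lambda>f. g x (f x) * g y (f y)))"
    by (simp add: int)
  also have "\<dots> = (\<Sum>x\<in>A. measure_pmf.expectation ?P (\<lambda>f. (g x (f x))\<^sup>2))"
  proof (rule sum.cong[OF refl])
    fix x assume x: "x \<in> A"
    have "(\<Sum>y\<in>A. measure_pmf.expectation ?P (\<lambda>f. g x (f x) * g y (f y)))
        = (\<Sum>y\<in>{x}. measure_pmf.expectation ?P (\<lambda>f. g x (f x) * g y (f y)))"
      by (rule sum.mono_neutral_right) (use A x cross in auto)
    then show "(\<Sum>y\<in>A. measure_pmf.expectation ?P (\<lambda>f. g x (f x) * g y (f y)))
        = measure_pmf.expectation ?P (\<lambda>f. (g x (f x))\<^sup>2)"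
      by (simp add: power2_eq_square)
  qed
  also have "\<dots> = (\<Sum>x\<in>A. measure_pmf.expectation (p x) (\<lambda>v. (g x v)\<^sup>2))"
    by (rule sum.cong[OF refl])
      (rule expectation_Pi_pmf_component[OF A, where g = "\<lambda>v. (g _ v)\<^sup>2"])
  finally show ?thesis .
qed

text \<open>Markov's inequality for the square of the centred sum. Real weights are allowed because
  the power analysis needs a statistic in which pairs inside the planted set and the remaining pairs
  are weighted differently.\<close>

lemma chebyshev_weighted_bernoulli:
  fixes q w :: "'a \<Rightarrow> real"
  assumes A: "finite A" and q: "\<And>x. x \<in> A \<Longrightarrow> 0 \<le> q x \<and> q x \<le> 1" and t: "t > 0"
  shows "measure_pmf.prob (Pi_pmf A False (\<lambda>x. bernoulli_pmf (q x)))
           {e. (\<Sum>x\<in>A. w x * of_bool (e x)) \<le> (\<Sum>x\<in>A. w x * q x) - t}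
         \<le> (\<Sum>x\<in>A. (w x)\<^sup>2 * (q x * (1 - q x))) / t\<^sup>2"
proof -
  let ?P = "Pi_pmf A False (\<lambda>x. bernoulli_pmf (q x))"
  define Y where "Y e = (\<Sum>x\<in>A. w x * (of_bool (e x) - q x))" for e
  have fin: "finite (set_pmf ?P)"
    by (rule finite_set_Pi_pmf[OF A]) (rule finite_subset[of _ UNIV], auto)
  have int: "integrable (measure_pmf ?P) h" for h :: "('a \<Rightarrow> bool) \<Rightarrow> real"
    by (rule integrable_measure_pmf_finite[OF fin])
  have "measure_pmf.expectation ?P (\<lambda>e. (Y e)\<^sup>2)
      = (\<Sum>x\<in>A. measure_pmf.expectation (bernoulli_pmf (q x)) (\<lambda>v. (w x * (of_bool v - q x))\<^sup>2))"
    unfolding Y_def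
    by (rule second_moment_sum_Pi_pmf[OF A, where g = "\<lambda>x v. w x * (of_bool v - q x)"])
      (use q in \<open>auto intro: finite_subset[of _ UNIV] simp: algebra_simps\<close>)
  also have "\<dots> = (\<Sum>x\<in>A. (w x)\<^sup>2 * (q x * (1 - q x)))"
    by (rule sum.cong[OF refl]) (use q in \<open>simp add: power2_eq_square algebra_simps\<close>)
  finally have var: "measure_pmf.expectation ?P (\<lambda>e. (Y e)\<^sup>2) = \<dots>" .
  have "measure_pmf.prob ?P {e. (\<Sum>x\<in>A. w x * of_bool (e x)) \<le> (\<Sum>x\<in>A. w x * q x) - t}
      \<le> measure_pmf.prob ?P {e \<in> space (measure_pmf ?P). (Y e)\<^sup>2 \<ge> t\<^sup>2}"
  proof (rule measure_pmf.finite_measure_mono)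
    show "{e. (\<Sum>x\<in>A. w x * of_bool (e x)) \<le> (\<Sum>x\<in>A. w x * q x) - t}
      \<subseteq> {e \<in> space (measure_pmf ?P). (Y e)\<^sup>2 \<ge> t\<^sup>2}"
    proof safe
      fix e assume "(\<Sum>x\<in>A. w x * of_bool (e x)) \<le> (\<Sum>x\<in>A. w x * q x) - t"
      then have "t \<le> - Y e"
        by (simp add: Y_def right_diff_distrib sum_subtractf)
      then have "t\<^sup>2 \<le> (- Y e)\<^sup>2"
        using t by (intro power_mono) auto
      then show "t\<^sup>2 \<le> (Y e)\<^sup>2" by simp
    qed simp
  qed simp
  also have "\<dots> \<le> measure_pmf.expectation ?P (\<lambda>e. (Y e)\<^sup>2) / t\<^sup>2"
    by (rule integral_Markov_inequality_measure[where A = "{}"]) (use int t in auto)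
  finally show ?thesis by (simp only: var)
qed

lemma chernoff_bernoulli:
  fixes p s y :: real
  assumes A: "finite A" and B: "B \<subseteq> A" and p: "0 \<le> p" "p \<le> 1" and s: "s \<ge> 0"
  shows "measure_pmf.prob (Pi_pmf A False (\<lambda>_. bernoulli_pmf p))
           {e. (\<Sum>x\<in>B. of_bool (e x)) \<ge> y}
         \<le> exp (- s * y) * (1 - p + p * exp s) ^ card B"
proof -
  let ?P = "Pi_pmf A False (\<lambda>_. bernoulli_pmf p)"
  define Z where "Z e = exp (s * (\<Sum>x\<in>B. of_bool (e x)))" for e
  \<comment> \<open>The factor \<open>f x\<close> is 1 off \<open>B\<close>: independence is applied
    to a product over all of \<open>A\<close>, while only \<open>B\<close> contributes to the
    expectation.\<close>
  define f where "f x v = exp (s * of_bool (x \<in> B \<and> v))" for x v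
  have fin: "finite (set_pmf ?P)"
    by (rule finite_set_Pi_pmf[OF A]) (rule finite_subset[of _ UNIV], auto)
  have finB: "finite B" using A B by (rule rev_finite_subset)
  have Z: "Z e = (\<Prod>x\<in>A. f x (e x))" for e
  proof -
    have "(\<Prod>x\<in>A. f x (e x)) = (\<Prod>x\<in>B. f x (e x))"
      by (rule prod.mono_neutral_right) (use A B in \<open>auto simp: f_def\<close>)
    then show ?thesis
      unfolding Z_def sum_distrib_left exp_sum[OF finB] by (simp add: f_def)
  qed
  have "measure_pmf.expectation ?P Z
      = (\<Prod>x\<in>A. measure_pmf.expectation (bernoulli_pmf p) (f x))"
    unfolding Z
    by (rule expectation_prod_Pi_pmf[OF A])
      (auto simp: f_def intro!: integrable_measure_pmf_finite intro: finite_subset[of _ UNIV])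
  also have "\<dots> = (\<Prod>x\<in>B. measure_pmf.expectation (bernoulli_pmf p) (f x))"
    by (rule prod.mono_neutral_right) (use A B p in \<open>auto simp: f_def\<close>)
  also have "\<dots> = (1 - p + p * exp s) ^ card B"
    using p by (simp add: f_def algebra_simps)
  finally have EZ: "measure_pmf.expectation ?P Z = \<dots>" .
  have "measure_pmf.prob ?P {e. (\<Sum>x\<in>B. of_bool (e x)) \<ge> y}
      \<le> measure_pmf.prob ?P {e \<in> space (measure_pmf ?P). Z e \<ge> exp (s * y)}"
    by (rule measure_pmf.finite_measure_mono) (use s in \<open>auto simp: Z_def mult_left_mono\<close>)
  also have "\<dots> \<le> measure_pmf.expectation ?P Z / exp (s * y)"
    by (rule integral_Markov_inequality_measure[where A = "{}"])
      (use fin in \<open>auto simp: Z_def intro: integrable_measure_pmf_finite\<close>)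
  finally show ?thesis
    by (simp add: EZ exp_minus field_simps)
qed

text \<open>The event lies in a single tail of \<open>X\<close>. Values are natural numbers, so
  there is a least threshold \<open>x\<close> whose tail has mass at most \<alpha>, and every
  \<open>w\<close> in the event satisfies \<open>X w \<ge> x\<close>. Without such a threshold the
  event is empty.\<close>

lemma pvalue_superuniform:
  fixes X :: "'a \<Rightarrow> nat"
  assumes "0 \<le> \<alpha>"
  shows "measure_pmf.prob P {w. measure_pmf.prob P {v. X v \<ge> X w} \<le> \<alpha>} \<le> \<alpha>"
proof (cases "\<exists>x. measure_pmf.prob P {v. X v \<ge> x} \<le> \<alpha>")
  case True
  define x where "x = (LEAST x. measure_pmf.prob P {v. X v \<ge> x} \<le> \<alpha>)"
  have x: "measure_pmf.prob P {v. X v \<ge> x} \<le> \<alpha>"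
    unfolding x_def using True by (rule LeastI_ex)
  have "measure_pmf.prob P {w. measure_pmf.prob P {v. X v \<ge> X w} \<le> \<alpha>}
      \<le> measure_pmf.prob P {v. X v \<ge> x}"
    by (rule measure_pmf.finite_measure_mono) (auto simp: x_def intro: Least_le)
  with x show ?thesis by simp
qed (use assms in simp)

text \<open>\<open>f\<close> is the maximum-likelihood parameter. On the log scale,
  \<open>ln u \<le> u - 1\<close> bounds the two summands by \<open>k * (p - f)\<close> and
  \<open>k * (f - p)\<close>, which cancel.\<close>

lemma bernoulli_likelihood_le:
  fixes p :: real and m k :: nat
  assumes p: "0 < p" "p < 1" and m: "m \<le> k"
  defines "f \<equiv> real m / real k"
  shows "p ^ m * (1 - p) ^ (k - m) \<le> f ^ m * (1 - f) ^ (k - m)"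
\<comment> \<open>At the endpoints \<open>f\<close> is 0 or 1 and the logarithms are unusable, but
  the right-hand side is then 1. This covers \<open>k = 0\<close>, where the quotient
  \<open>f\<close> is 0 by convention.\<close>
proof (cases "m = 0 \<or> m = k")
  case True
  then show ?thesis
    using p by (cases "k = 0") (auto simp: f_def power_le_one)
next
  case False
  with m have mk: "0 < m" "m < k" by auto
  then have f: "0 < f" "f < 1" by (auto simp: f_def)
  have fk: "real k * f = real m" using mk by (simp add: f_def)
  have "ln (p ^ m * (1 - p) ^ (k - m)) - ln (f ^ m * (1 - f) ^ (k - m))
     = real m * ln (p / f) + real (k - m) * ln ((1 - p) / (1 - f))"
    using p f by (simp add: ln_mult ln_div ln_realpow algebra_simps)
  also have "\<dots> \<le> real m * (p / f - 1) + real (k - m) * ((1 - p) / (1 - f) - 1)"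
    using p f by (intro add_mono mult_left_mono ln_le_minus_one) auto
  also have "real m * (p / f - 1) = real k * (p - f)"
    using f by (simp add: fk[symmetric] field_simps)
  also have "real (k - m) * ((1 - p) / (1 - f) - 1) = real k * (f - p)"
  proof -
    have "real (k - m) = real k * (1 - f)"
      using mk fk by (simp add: of_nat_diff algebra_simps)
    moreover have "(1 - p) / (1 - f) - 1 = (f - p) / (1 - f)"
      using f by (simp add: field_simps)
    ultimately show ?thesis using f by simp
  qed
  finally have "ln (p ^ m * (1 - p) ^ (k - m)) \<le> ln (f ^ m * (1 - f) ^ (k - m))"
    by (simp add: algebra_simps)
  then show ?thesis
    using p f by (subst (asm) ln_le_cancel_iff) auto
qed

subsection \<open>The scan statistic and the size of the calibrated test\<close>

lemma finite_upper_pairs [simp]: "finite S \<Longrightarrow> finite (upper_pairs S)"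
  by (rule finite_subset[of _ "S \<times> S"]) (auto simp: upper_pairs_def)

lemma upper_pairs_mono: "S \<subseteq> T \<Longrightarrow> upper_pairs S \<subseteq> upper_pairs T"
  by (auto simp: upper_pairs_def)

lemma card_upper_pairs:
  assumes "finite S"
  shows "real (card (upper_pairs S)) = pairs2 (card S)"
  using assms
proof (induction S rule: finite_linorder_max_induct)
  case empty
  then show ?case by (simp add: upper_pairs_def pairs2_def)
next
  case (insert b S)
  \<comment> \<open>As \<open>b\<close> exceeds every element of \<open>S\<close>, it can only be
    the second component of a new pair.\<close>
  have eq: "upper_pairs (insert b S) = upper_pairs S \<union> S \<times> {b}"
    using insert.hyps by (fastforce simp: upper_pairs_def)
  have "card (upper_pairs (insert b S)) = card (upper_pairs S) + card (S \<times> {b})"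
    unfolding eq by (rule card_Un_disjoint)
      (use insert.hyps in \<open>simp_all, auto simp: upper_pairs_def\<close>)
  moreover have "b \<notin> S" using insert.hyps by auto
  ultimately show ?case
    using insert by (simp add: pairs2_def field_simps)
qed

lemma finite_node_subsets [simp]: "finite (node_subsets N n)"
  by (rule finite_subset[of _ "Pow {1..N}"]) (auto simp: node_subsets_def)

lemma node_subsets_nonempty: "n \<le> N \<Longrightarrow> node_subsets N n \<noteq> {}"
  using obtain_subset_with_card_n[of n "{1..N}"] by (auto simp: node_subsets_def)

lemma card_node_subsets: "card (node_subsets N n) = N choose n"
  unfolding node_subsets_def using n_subsets[of "{1..N}" n] by simp

lemma sum_adj_of_edges:
  assumes "S \<subseteq> {1..N}"
  shows "(\<Sum>(i, j)\<in>upper_pairs S. adj_of_edges N e i j) = (\<Sum>x\<in>upper_pairs S. of_bool (e x))"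
  by (rule sum.cong) (use upper_pairs_mono[OF assms] in \<open>auto simp: adj_of_edges_def\<close>)

lemma p0_hat_adj_of_edges:
  "p0_hat N (adj_of_edges N e)
     = (\<Sum>x\<in>upper_pairs {1..N}. of_bool (e x)) / real (card (upper_pairs {1..N}))"
proof -
  have "(\<Sum>(i, j)\<in>upper_pairs {1..N}. real (adj_of_edges N e i j))
      = real (\<Sum>(i, j)\<in>upper_pairs {1..N}. adj_of_edges N e i j)"
    by (simp add: case_prod_unfold)
  also have "\<dots> = (\<Sum>x\<in>upper_pairs {1..N}. of_bool (e x))"
    by (subst sum_adj_of_edges) auto
  finally show ?thesis
    by (simp add: p0_hat_def card_upper_pairs)
qed

lemma scan_stat_adj_of_edges_ge_iff:
  assumes "n \<le> N"
  shows "real (scan_stat N n (adj_of_edges N e)) \<ge> x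
     \<longleftrightarrow> (\<exists>S\<in>node_subsets N n. (\<Sum>z\<in>upper_pairs S. of_bool (e z)) \<ge> x)"
proof -
  let ?F = "\<lambda>S. \<Sum>(i, j)\<in>upper_pairs S. adj_of_edges N e i j"
  let ?V = "?F ` node_subsets N n"
  have ne: "finite ?V" "?V \<noteq> {}" using node_subsets_nonempty[OF assms] by auto
  have F: "real (?F S) = (\<Sum>z\<in>upper_pairs S. of_bool (e z))" if "S \<in> node_subsets N n" for S
    using that by (subst sum_adj_of_edges) (auto simp: node_subsets_def)
  have "real (Max ?V) \<ge> x \<longleftrightarrow> (\<exists>v\<in>?V. real v \<ge> x)"
    using Max_in[OF ne] Max_ge[OF ne(1)] by (meson of_nat_le_iff order.trans)
  then show ?thesis
    unfolding scan_stat_def using F by auto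
qed

lemma scan_pvalue_le:
  assumes n: "n \<le> N" and p: "0 \<le> p" "p \<le> 1" and s: "s \<ge> 0"
  shows "scan_pvalue N n x p
     \<le> real (N choose n) * (exp (- s * x) * exp (pairs2 n * ln (1 - p + p * exp s)))"
proof -
  let ?P = "Pi_pmf (upper_pairs {1..N}) False (\<lambda>_. bernoulli_pmf p)"
  let ?E = "\<lambda>S. {e. (\<Sum>z\<in>upper_pairs S. of_bool (e z)) \<ge> x}"
  have pos: "0 < 1 - p + p * exp s"
  proof (cases "p = 0")
    case False
    then have "0 < p * exp s" using p by simp
    then show ?thesis using p by linarith
  qed simp
  have "scan_pvalue N n x p = measure_pmf.prob ?P (\<Union>S\<in>node_subsets N n. ?E S)"
    unfolding scan_pvalue_def erdos_renyi_def random_graph_def measure_map_pmf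
    by (rule arg_cong2[where f = measure_pmf.prob])
      (auto simp: vimage_def scan_stat_adj_of_edges_ge_iff[OF n] split_def)
  also have "\<dots> \<le> (\<Sum>S\<in>node_subsets N n. measure_pmf.prob ?P (?E S))"
    by (rule measure_pmf.finite_measure_subadditive_finite) auto
  also have "\<dots> \<le> (\<Sum>S\<in>node_subsets N n. exp (- s * x) * exp (pairs2 n * ln (1 - p + p * exp s)))"
  proof (rule sum_mono)
    fix S assume "S \<in> node_subsets N n"
    then have S: "S \<subseteq> {1..N}" "card S = n" "finite S"
      by (auto simp: node_subsets_def intro: finite_subset)
    have "measure_pmf.prob ?P (?E S) \<le> exp (- s * x) * (1 - p + p * exp s) ^ card (upper_pairs S)"
      by (rule chernoff_bernoulli) (use S p s upper_pairs_mono in auto)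
    also have "(1 - p + p * exp s) ^ card (upper_pairs S)
        = exp (pairs2 n * ln (1 - p + p * exp s))"
      using pos card_upper_pairs[OF S(3)] S(2) by (metis exp_ln exp_of_nat_mult)
    finally show "measure_pmf.prob ?P (?E S)
        \<le> exp (- s * x) * exp (pairs2 n * ln (1 - p + p * exp s))" .
  qed
  finally show ?thesis by (simp add: card_node_subsets)
qed

text \<open>The mass depends on \<open>e\<close> only through its number of edges, so comparing two
  parameters on graphs with equal edge counts is a scalar problem.\<close>

lemma pmf_bernoulli_edges:
  assumes A: "finite A" and e: "\<And>x. x \<notin> A \<Longrightarrow> \<not> e x" and p: "0 \<le> p" "p \<le> 1"
  defines "m \<equiv> card {x\<in>A. e x}"
  shows "pmf (Pi_pmf A False (\<lambda>_. bernoulli_pmf p)) e = p ^ m * (1 - p) ^ (card A - m)"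
proof -
  have "pmf (Pi_pmf A False (\<lambda>_. bernoulli_pmf p)) e = (\<Prod>x\<in>A. if e x then p else 1 - p)"
    using A e p by (subst pmf_Pi') (auto intro!: prod.cong)
  also have "\<dots> = p ^ card (A \<inter> {x. e x}) * (1 - p) ^ card (A \<inter> - {x. e x})"
    using A by (simp add: prod.If_cases)
  also have "A \<inter> {x. e x} = {x\<in>A. e x}" by auto
  also have "A \<inter> - {x. e x} = A - {x\<in>A. e x}" by auto
  also have "card (A - {x\<in>A. e x}) = card A - m"
    unfolding m_def using A by (intro card_Diff_subset) auto
  finally show ?thesis by (simp add: m_def)
qed

text \<open>
  On graphs with \<open>m\<close> edges the law with parameter \<open>p\<close> is dominated by the law whose parameter
  is the edge density of these graphs, under which the estimated p-value is super-uniform;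
  summing over \<open>m\<close> costs only a polynomial factor.
\<close>

lemma calibrated_scan_size:
  assumes p: "0 < p" "p < 1" and \<alpha>: "0 \<le> \<alpha>"
  shows "measure_pmf.prob (erdos_renyi N p) {W. calibrated_scan_test N n \<alpha> W = 1}
     \<le> (real (card (upper_pairs {1..N})) + 1) * \<alpha>"
proof -
  let ?A = "upper_pairs {1..N}"
  let ?M = "card ?A"
  define P where "P p = Pi_pmf ?A False (\<lambda>_. bernoulli_pmf p)" for p
  define R where "R = {e. calibrated_scan_test N n \<alpha> (adj_of_edges N e) = 1}"
  define E where "E m = {e. (\<forall>x. x \<notin> ?A \<longrightarrow> \<not> e x) \<and> card {x\<in>?A. e x} = m}" for m
  have er: "erdos_renyi N p = map_pmf (adj_of_edges N) (P p)" for p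
    by (simp add: erdos_renyi_def random_graph_def P_def split_def)
  have supp: "set_pmf (P p) \<subseteq> (\<Union>m\<in>{0..?M}. E m)"
  proof
    fix e assume "e \<in> set_pmf (P p)"
    then have "\<forall>x. x \<notin> ?A \<longrightarrow> \<not> e x"
      using set_Pi_pmf_subset[of ?A False "\<lambda>_. bernoulli_pmf p"] by (auto simp: P_def)
    moreover have "card {x\<in>?A. e x} \<le> ?M" by (rule card_mono) auto
    ultimately show "e \<in> (\<Union>m\<in>{0..?M}. E m)" by (auto simp: E_def)
  qed
  have finE: "finite (E m)" for m
  proof (rule finite_subset)
    show "E m \<subseteq> PiE_dflt ?A False (\<lambda>_. UNIV)" by (auto simp: E_def PiE_dflt_def)
  qed auto
  have slice: "measure_pmf.prob (P p) (R \<inter> E m) \<le> \<alpha>" if m: "m \<le> ?M" for m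
  proof -
    \<comment> \<open>If there are no pairs, \<open>?f\<close> is 0 by the convention for division,
      still an admissible parameter.\<close>
    let ?f = "real m / real ?M"
    have f: "0 \<le> ?f" "?f \<le> 1" using m by (auto simp: divide_le_eq_1)
    have pmf_P: "pmf (P q) e = q ^ m * (1 - q) ^ (?M - m)"
      if "e \<in> E m" "0 \<le> q" "q \<le> 1" for e q
      using that pmf_bernoulli_edges[of ?A e q] by (auto simp: P_def E_def)
    have le: "pmf (P p) e \<le> pmf (P ?f) e" if "e \<in> E m" for e
      using bernoulli_likelihood_le[OF p m] p f by (simp only: pmf_P[OF that])
    have "measure_pmf.prob (P p) (R \<inter> E m) = (\<Sum>e\<in>R \<inter> E m. pmf (P p) e)"
      by (rule measure_measure_pmf_finite) (use finE in auto)
    also have "\<dots> \<le> (\<Sum>e\<in>R \<inter> E m. pmf (P ?f) e)"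
      by (rule sum_mono) (use le in auto)
    also have "\<dots> = measure_pmf.prob (P ?f) (R \<inter> E m)"
      by (rule measure_measure_pmf_finite[symmetric]) (use finE in auto)
    also have "\<dots> \<le> measure_pmf.prob (P ?f)
        {e. measure_pmf.prob (P ?f)
          {e'. scan_stat N n (adj_of_edges N e') \<ge> scan_stat N n (adj_of_edges N e)} \<le> \<alpha>}"
    proof (rule measure_pmf.finite_measure_mono)
      have "p0_hat N (adj_of_edges N e) = ?f" if "e \<in> E m" for e
      proof -
        have "(\<Sum>x\<in>?A. of_bool (e x)) = real (card {x\<in>?A. e x})"
          by (simp add: of_bool_def sum.If_cases Int_def)
        then show ?thesis using that by (simp add: p0_hat_adj_of_edges E_def)
      qed
      then show "R \<inter> E m \<subseteq> {e. measure_pmf.prob (P ?f)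
          {e'. scan_stat N n (adj_of_edges N e') \<ge> scan_stat N n (adj_of_edges N e)} \<le> \<alpha>}"
        by (auto simp: R_def calibrated_scan_test_def scan_pvalue_def er vimage_def
            split: if_splits)
    qed simp
    also have "\<dots> \<le> \<alpha>" by (rule pvalue_superuniform[OF \<alpha>])
    finally show ?thesis .
  qed
  have "measure_pmf.prob (erdos_renyi N p) {W. calibrated_scan_test N n \<alpha> W = 1}
      = measure_pmf.prob (P p) R"
    by (simp add: er R_def vimage_def)
  also have "\<dots> = measure_pmf.prob (P p) (R \<inter> set_pmf (P p))"
    by (simp add: measure_Int_set_pmf)
  also have "\<dots> \<le> measure_pmf.prob (P p) (\<Union>m\<in>{0..?M}. R \<inter> E m)"
    by (rule measure_pmf.finite_measure_mono) (use supp in auto)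
  also have "\<dots> \<le> (\<Sum>m\<in>{0..?M}. measure_pmf.prob (P p) (R \<inter> E m))"
    by (rule measure_pmf.finite_measure_subadditive_finite) auto
  also have "\<dots> \<le> (\<Sum>m\<in>{0..?M}. \<alpha>)"
    by (rule sum_mono) (use slice in auto)
  finally show ?thesis by (simp add: algebra_simps)
qed

subsection \<open>Entropy bounds\<close>

lemma entropy_fun_alt:
  assumes "0 < p" "p < 1" "0 < q" "q < 1"
  shows "entropy_fun p q = q * ln (q / p) - (1 - q) * ln ((1 - p) / (1 - q))"
  using assms by (simp add: entropy_fun_def ln_div algebra_simps)

text \<open>Passing to square roots before using \<open>ln u \<le> u - 1\<close> yields differences
  of square roots, the quantities that the entropy controls.\<close>

lemma ln_ratio_le_sqrt:
  assumes "0 < (x::real)" "0 < y"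
  shows "ln (y / x) \<le> 2 * ((sqrt y - sqrt x) / sqrt x)"
proof -
  have "ln (y / x) = 2 * ln (sqrt y / sqrt x)"
    using assms by (simp add: ln_div ln_sqrt)
  also have "ln (sqrt y / sqrt x) \<le> sqrt y / sqrt x - 1"
    using assms by (intro ln_le_minus_one) auto
  also have "sqrt y / sqrt x - 1 = (sqrt y - sqrt x) / sqrt x"
    using assms by (simp add: field_simps)
  finally show ?thesis by simp
qed

text \<open>Relative entropy dominates the squared Hellinger distance. The preceding bound is
  applied to each of the two outcomes, and the linear terms add up to 2.\<close>

lemma entropy_fun_ge_hellinger:
  assumes "0 < p" "p < 1" "0 < q" "q < 1"
  shows "(sqrt q - sqrt p)\<^sup>2 + (sqrt (1 - q) - sqrt (1 - p))\<^sup>2 \<le> entropy_fun p q"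
proof -
  have *: "2 * y - 2 * (sqrt x * sqrt y) \<le> y * ln (y / x)" if "0 < x" "0 < y" for x y :: real
  proof -
    have "y * ln (x / y) \<le> y * (2 * ((sqrt x - sqrt y) / sqrt y))"
      using that by (intro mult_left_mono ln_ratio_le_sqrt) auto
    also have "\<dots> = (sqrt y * sqrt y) * (2 * ((sqrt x - sqrt y) / sqrt y))"
      using that by simp
    also have "\<dots> = 2 * (sqrt x * sqrt y) - 2 * (sqrt y * sqrt y)"
      using that by (simp add: field_simps del: real_sqrt_mult_self)
    finally show ?thesis using that by (simp add: ln_div algebra_simps)
  qed
  have "(sqrt q - sqrt p)\<^sup>2 + (sqrt (1 - q) - sqrt (1 - p))\<^sup>2
     = (2 * q - 2 * (sqrt p * sqrt q)) + (2 * (1 - q) - 2 * (sqrt (1 - p) * sqrt (1 - q)))"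
    using assms by (simp add: power2_diff)
  also have "\<dots> \<le> entropy_fun p q"
    unfolding entropy_fun_def by (intro add_mono *) (use assms in auto)
  finally show ?thesis .
qed

lemma entropy_fun_nonneg:
  assumes "0 < p" "p < 1" "0 < q" "q < 1"
  shows "0 \<le> entropy_fun p q"
  by (rule order.trans[OF _ entropy_fun_ge_hellinger[OF assms]]) simp

text \<open>The threshold 8 exceeds the square of \<open>exp 1\<close>, so the logarithm is at least
  2. The second summand of the entropy costs at most \<open>q\<close>, hence at most half of
  \<open>q * ln (q / p)\<close>.\<close>

lemma entropy_fun_ge_large_ratio:
  assumes "0 < p" "p \<le> q" "q < 1" "8 * p < q"
  shows "2 \<le> ln (q / p)" "q * ln (q / p) / 2 \<le> entropy_fun p q"
proof -
  have "exp (2::real) = exp 1 * exp 1" by (simp flip: exp_add)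
  also have "\<dots> \<le> 2.75 * 2.75"
    using e_less_272 by (intro mult_mono) auto
  also have "\<dots> \<le> q / p" using assms by (simp add: field_simps)
  finally show a: "2 \<le> ln (q / p)"
    using assms by (subst ln_ge_iff) auto
  have "(1 - q) * ln ((1 - p) / (1 - q)) \<le> (1 - q) * ((1 - p) / (1 - q) - 1)"
    using assms by (intro mult_left_mono ln_le_minus_one) auto
  also have "\<dots> = q - p" using assms by (simp add: field_simps)
  finally have "q * (ln (q / p) - 1) \<le> entropy_fun p q"
    using assms by (subst entropy_fun_alt) (auto simp: algebra_simps)
  moreover have "q * (ln (q / p) / 2) \<le> q * (ln (q / p) - 1)"
    using a assms by (intro mult_left_mono) auto
  ultimately show "q * ln (q / p) / 2 \<le> entropy_fun p q" by simp
qed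

text \<open>Used to control the fluctuation of the estimated density. For
  \<open>q \<le> 8 * p\<close>, factor \<open>q - p\<close> through square roots and use the
  Hellinger bound; \<open>18 = 2 * 8 + 2\<close> bounds the square of the sum of the roots. For
  larger \<open>q\<close>, the entropy exceeds \<open>q - p\<close> itself.\<close>

lemma sq_diff_le_entropy:
  assumes pq: "0 < p" "p \<le> q" "q < 1"
  shows "(q - p)\<^sup>2 \<le> 18 * p * entropy_fun p q + (entropy_fun p q)\<^sup>2"
proof -
  let ?H = "entropy_fun p q"
  have H: "0 \<le> ?H" using pq by (intro entropy_fun_nonneg) auto
  show ?thesis
  proof (cases "q \<le> 8 * p")
    case True
    have "(q - p)\<^sup>2 = ((sqrt q - sqrt p) * (sqrt q + sqrt p))\<^sup>2"
      using pq by (simp add: algebra_simps)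
    also have "\<dots> = (sqrt q - sqrt p)\<^sup>2 * (sqrt q + sqrt p)\<^sup>2"
      by (simp add: power_mult_distrib)
    also have "\<dots> \<le> ?H * (18 * p)"
    proof (rule mult_mono)
      show "(sqrt q - sqrt p)\<^sup>2 \<le> ?H"
        using entropy_fun_ge_hellinger[of p q] pq
        by (smt (verit) zero_le_power2)
      have "(sqrt q + sqrt p)\<^sup>2 \<le> 2 * (sqrt q)\<^sup>2 + 2 * (sqrt p)\<^sup>2"
        using zero_le_power2[of "sqrt q - sqrt p"] by (simp only: power2_sum power2_diff)
      then show "(sqrt q + sqrt p)\<^sup>2 \<le> 18 * p" using True pq by simp
    qed (use H in auto)
    finally show ?thesis
      using zero_le_power2[of ?H] by (simp add: mult.commute mult.left_commute add_increasing2)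
  next
    case False
    then have l: "2 \<le> ln (q / p)" and "q * ln (q / p) / 2 \<le> ?H"
      using entropy_fun_ge_large_ratio[of p q] pq by auto
    moreover have "q * 2 \<le> q * ln (q / p)" using l pq by (intro mult_left_mono) auto
    ultimately have "q - p \<le> ?H" using pq by linarith
    then have "(q - p)\<^sup>2 \<le> ?H\<^sup>2" using pq by (intro power_mono) auto
    moreover have "0 \<le> 18 * p * ?H" using pq H by simp
    ultimately show ?thesis by linarith
  qed
qed

text \<open>
  The left-hand side is the variance, under parameter \<open>q\<close>, of the log-likelihood ratio of a
  single edge; its mean is \<open>entropy_fun p q\<close>.
\<close>

lemma llr_variance_le_entropy:
  assumes pq: "0 < p" "p \<le> q" "q < 1"
  shows "(ln (q / p) + ln ((1 - p) / (1 - q)))\<^sup>2 * (q * (1 - q))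
     \<le> 72 * entropy_fun p q + 8 * ((entropy_fun p q)\<^sup>2 / q)"
proof -
  define H where "H = entropy_fun p q"
  define a where "a = ln (q / p)"
  define b where "b = ln ((1 - p) / (1 - q))"
  have H: "0 \<le> H" unfolding H_def using pq by (intro entropy_fun_nonneg) auto
  have hell: "(sqrt q - sqrt p)\<^sup>2 \<le> H" "(sqrt (1 - q) - sqrt (1 - p))\<^sup>2 \<le> H"
    using entropy_fun_ge_hellinger[of p q] pq unfolding H_def
    by (smt (verit) zero_le_power2)+
  have a0: "0 \<le> a" and b0: "0 \<le> b" using pq by (auto simp: a_def b_def)
  \<comment> \<open>For \<open>q \<le> 8 * p\<close> the square-root bound on the logarithm gives
    \<open>4 * 8 = 32\<close>; beyond that ratio \<open>q * a / 2 \<le> H\<close>, which is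
    squared.\<close>
  have a: "a\<^sup>2 * q \<le> 32 * H + 4 * (H\<^sup>2 / q)"
  proof (cases "q \<le> 8 * p")
    case True
    have "a\<^sup>2 \<le> (2 * ((sqrt q - sqrt p) / sqrt p))\<^sup>2"
      unfolding a_def using pq a0 by (intro power_mono ln_ratio_le_sqrt) (auto simp: a_def)
    also have "\<dots> = 4 * (sqrt q - sqrt p)\<^sup>2 / p"
      unfolding power_mult_distrib power_divide using pq by simp
    finally have "a\<^sup>2 * q \<le> 4 * (sqrt q - sqrt p)\<^sup>2 / p * q"
      using pq by (intro mult_right_mono) auto
    also have "\<dots> = 4 * (sqrt q - sqrt p)\<^sup>2 * (q / p)" by simp
    also have "\<dots> \<le> 4 * H * 8"
      using pq True hell H by (intro mult_mono) (auto simp: field_simps)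
    finally show ?thesis using pq by (smt (verit) divide_nonneg_pos zero_le_power2)
  next
    case False
    then have "q * a / 2 \<le> H"
      using entropy_fun_ge_large_ratio[of p q] pq by (auto simp: a_def H_def)
    then have "(q * a / 2)\<^sup>2 \<le> H\<^sup>2"
      using pq a0 by (intro power_mono) auto
    then have "a\<^sup>2 * q \<le> 4 * (H\<^sup>2 / q)"
      using pq by (simp add: field_simps power2_eq_square)
    then show ?thesis using H by simp
  qed
  have b: "b\<^sup>2 * (1 - q) \<le> 4 * H"
  proof -
    have "b\<^sup>2 \<le> (2 * ((sqrt (1 - p) - sqrt (1 - q)) / sqrt (1 - q)))\<^sup>2"
      unfolding b_def using pq b0 by (intro power_mono ln_ratio_le_sqrt) (auto simp: b_def)
    also have "\<dots> = 4 * (sqrt (1 - q) - sqrt (1 - p))\<^sup>2 / (1 - q)"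
      unfolding power_mult_distrib power_divide using pq by (simp add: power2_commute)
    finally have "b\<^sup>2 * (1 - q) \<le> 4 * (sqrt (1 - q) - sqrt (1 - p))\<^sup>2"
      using pq by (simp add: field_simps)
    then show ?thesis using hell by linarith
  qed
  \<comment> \<open>Doubling both bounds gives the constants \<open>2 * (32 + 4) = 72\<close> and
    \<open>2 * 4 = 8\<close>.\<close>
  have "(a + b)\<^sup>2 \<le> 2 * a\<^sup>2 + 2 * b\<^sup>2"
    using zero_le_power2[of "a - b"] by (simp only: power2_sum power2_diff)
  then have "(a + b)\<^sup>2 * (q * (1 - q)) \<le> (2 * a\<^sup>2 + 2 * b\<^sup>2) * (q * (1 - q))"
    using pq by (intro mult_right_mono) auto
  also have "\<dots> = 2 * (a\<^sup>2 * q) * (1 - q) + 2 * (b\<^sup>2 * (1 - q)) * q"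
    by (simp add: algebra_simps)
  also have "\<dots> \<le> 2 * (a\<^sup>2 * q) * 1 + 2 * (b\<^sup>2 * (1 - q)) * 1"
    using pq by (intro add_mono mult_left_mono) auto
  finally show ?thesis
    using a b unfolding a_def[symmetric] b_def[symmetric] H_def[symmetric] by linarith
qed

subsection \<open>Power of the calibrated test\<close>

text \<open>
  \<open>s\<close> is the optimal Chernoff exponent for the true parameters \<open>p, q\<close>; for an estimate
  \<open>h\<close> of \<open>p\<close> the cumulant generating function is replaced by its tangent at \<open>p\<close>.
\<close>

lemma scan_pvalue_le_entropy:
  fixes p q h t :: real
  assumes n: "n \<le> N" and pq: "0 < p" "p \<le> q" "q < 1" and h: "0 \<le> h" "h \<le> 1"
  defines "s \<equiv> ln (q / p) + ln ((1 - p) / (1 - q))"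
    and "r \<equiv> (q - p) / (p * (1 - p))" and "k \<equiv> pairs2 n"
  assumes k: "0 \<le> k" and x: "s * x - k * r * h \<ge> s * (k * q) - k * r * p - t"
  shows "scan_pvalue N n x h \<le> real (N choose n) * exp (t - k * entropy_fun p q)"
proof -
  define b where "b = ln ((1 - p) / (1 - q))"
  have s0: "0 \<le> s" using pq by (auto simp: s_def intro: add_nonneg_nonneg)
  have es: "exp s = q * (1 - p) / (p * (1 - q))"
    using pq by (simp add: s_def exp_add)
  define z where "z = 1 - h + h * exp s"
  \<comment> \<open>\<open>z0\<close> is the value of \<open>z\<close> at \<open>h = p\<close>, and
    \<open>b\<close> is its logarithm. Since \<open>z\<close> is affine in \<open>h\<close>,
    \<open>z / z0 - 1\<close> is exactly \<open>r * (h - p)\<close>, the tangent increment of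
    \<open>ln z\<close> at \<open>p\<close>.\<close>
  define z0 where "z0 = (1 - p) / (1 - q)"
  have "h * 1 \<le> h * exp s" using h s0 by (intro mult_left_mono) auto
  then have z: "0 < z" by (simp add: z_def)
  have z0: "0 < z0" using pq by (simp add: z0_def)
  have "ln z - b = ln (z / z0)" using z z0 by (simp add: b_def z0_def[symmetric] ln_div)
  also have "\<dots> \<le> z / z0 - 1" using z z0 by (intro ln_le_minus_one) auto
  also have "z / z0 - 1 = r * (h - p)"
  proof -
    have "p \<noteq> 0" "1 - p \<noteq> 0" "1 - q \<noteq> 0" using pq by auto
    then show ?thesis
      unfolding z_def z0_def es r_def by (simp add: divide_simps) (simp add: algebra_simps)
  qed
  finally have ln_z: "ln z \<le> b + r * (h - p)" by simp
  have H: "entropy_fun p q = s * q - b"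
    using pq by (subst entropy_fun_alt) (auto simp: s_def b_def algebra_simps)
  have "- s * x + k * ln z \<le> - s * x + k * (b + r * (h - p))"
    using ln_z k by (intro add_left_mono mult_left_mono)
  also have "\<dots> \<le> t - k * entropy_fun p q"
    using x by (simp add: H algebra_simps)
  finally have "exp (- s * x) * exp (k * ln z) \<le> exp (t - k * entropy_fun p q)"
    by (simp flip: exp_add)
  then have "real (N choose n) * (exp (- s * x) * exp (k * ln z))
      \<le> real (N choose n) * exp (t - k * entropy_fun p q)"
    by (rule mult_left_mono) simp
  then show ?thesis
    using scan_pvalue_le[OF n h s0, of x] unfolding k_def z_def by linarith
qed

text \<open>Acceptance forces a linear statistic of the edges to fall at least \<open>t\<close>
  below its mean, and Chebyshev's inequality applies. In the bound, the first summand comes from the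
  edges inside \<open>S\<close>, the second from the estimation of \<open>p\<close>.\<close>

lemma calibrated_scan_type_II:
  fixes p q p' t \<alpha> :: real
  assumes n: "2 \<le> n" "n \<le> N" and p': "0 < p'" "p' \<le> q" and q: "q < 1"
    and S: "S \<in> node_subsets N n"
    and p_def: "p = null_prob N n p' q" and t: "0 < t"
  defines "s \<equiv> ln (q / p) + ln ((1 - p) / (1 - q))"
    and "r \<equiv> (q - p) / (p * (1 - p))" and "k \<equiv> pairs2 n" and "M \<equiv> pairs2 N"
  assumes \<alpha>: "real (N choose n) * exp (t - k * entropy_fun p q) \<le> \<alpha>"
  shows "measure_pmf.prob (alt_law N S p' q) {W. calibrated_scan_test N n \<alpha> W = 0}
    \<le> (2 * s\<^sup>2 * k * (q * (1 - q)) + 2 * k\<^sup>2 * r\<^sup>2 * p / M) / t\<^sup>2"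
proof -
  let ?A = "upper_pairs {1..N}"
  define Q where "Q x = (if x \<in> upper_pairs S then q else p')" for x
  \<comment> \<open>The weighted edge sum is \<open>s\<close> times the number of edges inside
    \<open>S\<close> minus \<open>k * r\<close> times the estimated density. That density counts the
    pairs of \<open>S\<close> too, so they carry both terms.\<close>
  define w where "w x = s * of_bool (x \<in> upper_pairs S) - k * r / M" for x
  define P where "P = Pi_pmf ?A False (\<lambda>x. bernoulli_pmf (Q x))"
  have S: "S \<subseteq> {1..N}" "card S = n" "finite S" "S \<in> node_subsets N n"
    using S by (auto simp: node_subsets_def intro: finite_subset)
  have sub: "upper_pairs S \<subseteq> ?A" using S upper_pairs_mono by auto
  have cardA: "real (card ?A) = M" and cardS: "real (card (upper_pairs S)) = k"
    using card_upper_pairs[of "{1..N}"] card_upper_pairs[OF S(3)] S by (auto simp: M_def k_def)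
  have k: "0 < k" "k \<le> M"
    using n card_mono[OF _ sub] cardA cardS by (auto simp: k_def pairs2_def)
  then have M: "0 < M" by simp
  \<comment> \<open>The fixed expected total degree: null and alternative have equal mean edge
    counts, so the estimated density has mean \<open>p\<close> under the alternative.\<close>
  have Mp: "M * p = q * k + p' * (M - k)"
    using M by (simp add: p_def null_prob_def k_def[symmetric] M_def[symmetric] field_simps)
  have "p = p' + (q - p') * (k / M)"
    by (simp add: p_def null_prob_def k_def M_def)
  moreover have "(q - p') * (k / M) \<le> q - p'"
    by (rule mult_left_le) (use k M p' in auto)
  moreover have "0 \<le> (q - p') * (k / M)"
    using k M p' by simp
  ultimately have pq: "0 < p" "p \<le> q" using p' by linarith+
  have s0: "0 \<le> s" using pq q by (auto simp: s_def intro: add_nonneg_nonneg)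
  have Q: "0 \<le> Q x \<and> Q x \<le> 1" for x using p' q by (auto simp: Q_def)
  have sum_S: "(\<Sum>x\<in>?A. of_bool (x \<in> upper_pairs S) * f x) = (\<Sum>x\<in>upper_pairs S. f x)"
    for f :: "_ \<Rightarrow> real"
    by (rule sum.mono_neutral_cong_right) (use sub in auto)
  have sum_Q: "(\<Sum>x\<in>?A. Q x) = M * p"
  proof -
    have "(\<Sum>x\<in>?A. Q x) = (\<Sum>x\<in>?A. p' + of_bool (x \<in> upper_pairs S) * (q - p'))"
      by (rule sum.cong) (auto simp: Q_def)
    also have "\<dots> = M * p' + k * (q - p')"
      by (simp only: sum.distrib sum_S sum_constant cardA cardS)
    finally show ?thesis by (simp add: Mp algebra_simps)
  qed
  have alt: "alt_law N S p' q = map_pmf (adj_of_edges N) P"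
    unfolding alt_law_def random_graph_def P_def
    by (intro arg_cong[where f = "map_pmf _"] Pi_pmf_cong)
      (auto simp: Q_def upper_pairs_def split: if_splits)
  have mean: "(\<Sum>x\<in>?A. w x * Q x) = s * (k * q) - k * r * p"
  proof -
    have "(\<Sum>x\<in>?A. w x * Q x)
        = s * (\<Sum>x\<in>?A. of_bool (x \<in> upper_pairs S) * Q x) - k * r / M * (\<Sum>x\<in>?A. Q x)"
      by (simp add: w_def left_diff_distrib sum_subtractf sum_distrib_left mult.assoc
          del: sum_of_bool_mult_eq sum_mult_of_bool_eq)
    also have "(\<Sum>x\<in>?A. of_bool (x \<in> upper_pairs S) * Q x) = k * q"
      unfolding sum_S by (simp add: Q_def cardS)
    finally show ?thesis unfolding sum_Q using M by simp
  qed
  have obs: "(\<Sum>x\<in>?A. w x * of_bool (e x))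
      = s * (\<Sum>x\<in>upper_pairs S. of_bool (e x)) - k * r * p0_hat N (adj_of_edges N e)" for e
  proof -
    have "(\<Sum>x\<in>?A. w x * of_bool (e x))
        = s * (\<Sum>x\<in>?A. of_bool (x \<in> upper_pairs S) * of_bool (e x))
          - k * r / M * (\<Sum>x\<in>?A. of_bool (e x))"
      by (simp add: w_def left_diff_distrib sum_subtractf sum_distrib_left mult.assoc
          del: sum_of_bool_mult_eq sum_mult_of_bool_eq sum_of_bool_eq)
    then show ?thesis
      by (simp only: sum_S p0_hat_adj_of_edges cardA) simp
  qed
  have "{e. calibrated_scan_test N n \<alpha> (adj_of_edges N e) = 0}
      \<subseteq> {e. (\<Sum>x\<in>?A. w x * of_bool (e x)) \<le> (\<Sum>x\<in>?A. w x * Q x) - t}"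
  proof safe
    fix e assume T: "calibrated_scan_test N n \<alpha> (adj_of_edges N e) = 0"
    let ?h = "p0_hat N (adj_of_edges N e)"
    let ?x = "real (scan_stat N n (adj_of_edges N e))"
    have "(\<Sum>x\<in>?A. of_bool (e x)) \<le> (\<Sum>x\<in>?A. 1::real)" by (rule sum_mono) simp
    then have "(\<Sum>x\<in>?A. of_bool (e x)) \<le> M" by (simp only: sum_constant cardA mult_1_right)
    then have h: "0 \<le> ?h" "?h \<le> 1"
      using M unfolding p0_hat_adj_of_edges cardA
      by (auto simp: divide_le_eq_1 intro!: divide_nonneg_nonneg sum_nonneg
          simp del: sum_of_bool_eq)
    \<comment> \<open>The planted set is one of the competitors in the scan, and \<open>s\<close> is
      nonnegative.\<close>
    have "(\<Sum>x\<in>upper_pairs S. of_bool (e x)) \<le> ?x"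
      unfolding scan_stat_adj_of_edges_ge_iff[OF n(2)] by (rule bexI[OF order.refl S(4)])
    then have "s * (\<Sum>x\<in>upper_pairs S. of_bool (e x)) \<le> s * ?x"
      using s0 by (rule mult_left_mono)
    moreover have "\<not> s * ?x - k * r * ?h \<ge> s * (k * q) - k * r * p - t"
    proof
      assume "s * ?x - k * r * ?h \<ge> s * (k * q) - k * r * p - t"
      then have "scan_pvalue N n ?x ?h \<le> real (N choose n) * exp (t - k * entropy_fun p q)"
        using scan_pvalue_le_entropy[OF n(2) pq q h, folded s_def r_def k_def] k by simp
      with \<alpha> T show False by (simp add: calibrated_scan_test_def split: if_splits)
    qed
    ultimately show "(\<Sum>x\<in>?A. w x * of_bool (e x)) \<le> (\<Sum>x\<in>?A. w x * Q x) - t"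
      unfolding obs mean by linarith
  qed
  then have "measure_pmf.prob (alt_law N S p' q) {W. calibrated_scan_test N n \<alpha> W = 0}
      \<le> measure_pmf.prob P {e. (\<Sum>x\<in>?A. w x * of_bool (e x)) \<le> (\<Sum>x\<in>?A. w x * Q x) - t}"
    unfolding alt measure_map_pmf vimage_def mem_Collect_eq
    by (rule measure_pmf.finite_measure_mono) simp
  also have "\<dots> \<le> (\<Sum>x\<in>?A. (w x)\<^sup>2 * (Q x * (1 - Q x))) / t\<^sup>2"
    unfolding P_def by (rule chebyshev_weighted_bernoulli) (use Q t in auto)
  also have "\<dots> \<le> (2 * s\<^sup>2 * k * (q * (1 - q)) + 2 * k\<^sup>2 * r\<^sup>2 * p / M) / t\<^sup>2"
  proof (rule divide_right_mono)
    \<comment> \<open>Separate the two parts of the weight. Bounding the variance by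
      \<open>Q x\<close> in the second part makes its sum the mean edge count
      \<open>M * p\<close>.\<close>
    have "(\<Sum>x\<in>?A. (w x)\<^sup>2 * (Q x * (1 - Q x)))
        \<le> (\<Sum>x\<in>?A. of_bool (x \<in> upper_pairs S) * (2 * s\<^sup>2 * (q * (1 - q)))
            + 2 * (k * r / M)\<^sup>2 * Q x)"
    proof (rule sum_mono)
      fix x
      let ?i = "of_bool (x \<in> upper_pairs S) :: real"
      have "(w x)\<^sup>2 \<le> 2 * (s * ?i)\<^sup>2 + 2 * (k * r / M)\<^sup>2"
        using zero_le_power2[of "s * ?i + k * r / M"]
        unfolding w_def by (simp only: power2_sum power2_diff)
      then have "(w x)\<^sup>2 * (Q x * (1 - Q x))
          \<le> (2 * (s * ?i)\<^sup>2 + 2 * (k * r / M)\<^sup>2) * (Q x * (1 - Q x))"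
        using Q[of x] by (intro mult_right_mono) auto
      also have "\<dots> = 2 * (s * ?i)\<^sup>2 * (Q x * (1 - Q x))
          + 2 * (k * r / M)\<^sup>2 * (Q x * (1 - Q x))"
        by (rule distrib_right)
      also have "2 * (s * ?i)\<^sup>2 * (Q x * (1 - Q x)) = ?i * (2 * s\<^sup>2 * (q * (1 - q)))"
        by (cases "x \<in> upper_pairs S") (simp_all add: Q_def)
      also have "2 * (k * r / M)\<^sup>2 * (Q x * (1 - Q x)) \<le> 2 * (k * r / M)\<^sup>2 * Q x"
        using Q[of x] by (intro mult_left_mono mult_left_le) auto
      finally show "(w x)\<^sup>2 * (Q x * (1 - Q x))
          \<le> ?i * (2 * s\<^sup>2 * (q * (1 - q))) + 2 * (k * r / M)\<^sup>2 * Q x" by simp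
    qed
    also have "\<dots> = k * (2 * s\<^sup>2 * (q * (1 - q))) + 2 * (k * r / M)\<^sup>2 * (M * p)"
      by (simp only: sum.distrib sum_S sum_distrib_left[symmetric] sum_Q) (simp add: cardS)
    also have "2 * (k * r / M)\<^sup>2 * (M * p) = 2 * k\<^sup>2 * r\<^sup>2 * p * (M / M\<^sup>2)"
      by (simp add: power_divide power_mult_distrib)
    also have "M / M\<^sup>2 = 1 / M"
      using M by (simp add: power2_eq_square)
    also have "k * (2 * s\<^sup>2 * (q * (1 - q))) + 2 * k\<^sup>2 * r\<^sup>2 * p * (1 / M)
        = 2 * s\<^sup>2 * k * (q * (1 - q)) + 2 * k\<^sup>2 * r\<^sup>2 * p / M"
      by (simp add: mult_ac)
    finally show "(\<Sum>x\<in>?A. (w x)\<^sup>2 * (Q x * (1 - Q x)))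
      \<le> 2 * s\<^sup>2 * k * (q * (1 - q)) + 2 * k\<^sup>2 * r\<^sup>2 * p / M" .
  qed simp
  finally show ?thesis .
qed

text \<open>The deviation is a fixed fraction \<epsilon> of \<open>k * H\<close>. The two variance
  estimates reduce the bound to quotients whose denominators \<open>k * H\<close>,
  \<open>k * q\<close>, \<open>M * H\<close> and \<open>M * p\<close> all diverge in the asymptotic
  regime.\<close>

lemma type_II_bound_le:
  fixes p q k M \<epsilon> :: real
  assumes pq: "0 < p" "p \<le> q" "q < 1" and k: "0 < k" and M: "0 < M" and \<epsilon>: "0 < \<epsilon>"
  defines "s \<equiv> ln (q / p) + ln ((1 - p) / (1 - q))"
    and "r \<equiv> (q - p) / (p * (1 - p))" and "H \<equiv> entropy_fun p q"
  assumes H: "0 < H"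
  shows "(2 * s\<^sup>2 * k * (q * (1 - q)) + 2 * k\<^sup>2 * r\<^sup>2 * p / M) / (\<epsilon> * k * H)\<^sup>2
    \<le> 2 / \<epsilon>\<^sup>2 * (72 / (k * H) + 8 / (k * q) + (18 / (M * H) + 1 / (M * p)) / (1 - p)\<^sup>2)"
proof -
  have q: "0 < q" "p < 1" using pq by auto
  have "s\<^sup>2 * (q * (1 - q)) / (k * H\<^sup>2) \<le> (72 * H + 8 * (H\<^sup>2 / q)) / (k * H\<^sup>2)"
    unfolding s_def H_def
    by (rule divide_right_mono[OF llr_variance_le_entropy[OF pq]]) (use k in simp)
  also have "\<dots> = 72 / (k * H) + 8 / (k * q)"
    using H k q by (simp add: field_simps power2_eq_square)
  finally have 1: "s\<^sup>2 * (q * (1 - q)) / (k * H\<^sup>2) \<le> 72 / (k * H) + 8 / (k * q)" .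
  have "r\<^sup>2 * p / (M * H\<^sup>2) = (q - p)\<^sup>2 / (p * M * H\<^sup>2 * (1 - p)\<^sup>2)"
    using pq q by (simp add: r_def power_divide power_mult_distrib) (simp add: power2_eq_square)
  also have "\<dots> \<le> (18 * p * H + H\<^sup>2) / (p * M * H\<^sup>2 * (1 - p)\<^sup>2)"
    unfolding H_def
    by (rule divide_right_mono[OF sq_diff_le_entropy[OF pq]]) (use pq M in simp)
  also have "\<dots> = ((18 * p * H + H\<^sup>2) / (p * M * H\<^sup>2)) / (1 - p)\<^sup>2" by simp
  also have "(18 * p * H + H\<^sup>2) / (p * M * H\<^sup>2) = 18 / (M * H) + 1 / (M * p)"
    using H M pq by (simp add: field_simps power2_eq_square)
  finally have 2: "r\<^sup>2 * p / (M * H\<^sup>2) \<le> (18 / (M * H) + 1 / (M * p)) / (1 - p)\<^sup>2" .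
  have "(2 * s\<^sup>2 * k * (q * (1 - q)) + 2 * k\<^sup>2 * r\<^sup>2 * p / M) / (\<epsilon> * k * H)\<^sup>2
     = 2 / \<epsilon>\<^sup>2 * (s\<^sup>2 * (q * (1 - q)) / (k * H\<^sup>2) + r\<^sup>2 * p / (M * H\<^sup>2))"
  proof -
    have "2 * s\<^sup>2 * k * (q * (1 - q)) / (\<epsilon> * k * H)\<^sup>2
        = 2 / \<epsilon>\<^sup>2 * (s\<^sup>2 * (q * (1 - q)) / (k * H\<^sup>2))"
      using k by (simp add: power_mult_distrib) (simp add: power2_eq_square)
    moreover have "2 * k\<^sup>2 * r\<^sup>2 * p / M / (\<epsilon> * k * H)\<^sup>2 = 2 / \<epsilon>\<^sup>2 * (r\<^sup>2 * p / (M * H\<^sup>2))"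
      using k by (simp add: power_mult_distrib)
    ultimately show ?thesis by (simp only: add_divide_distrib distrib_left)
  qed
  also have "\<dots> \<le> 2 / \<epsilon>\<^sup>2 * ((72 / (k * H) + 8 / (k * q))
      + (18 / (M * H) + 1 / (M * p)) / (1 - p)\<^sup>2)"
    using 1 2 by (intro mult_left_mono add_mono) auto
  finally show ?thesis .
qed

section \<open>Choice of the level and explicit risk bound\<close>

lemma choose_le_exp:
  assumes "0 < n" "n \<le> N"
  shows "real (N choose n) \<le> exp (real n * ln (real N / real n) + real n)"
proof -
  have "real (N choose n) * fact n \<le> real N ^ n"
    using binomial_fact_pow[of N n] by (metis of_nat_fact of_nat_le_iff of_nat_mult of_nat_power)
  moreover have "real n ^ n / fact n \<le> exp (real n)"
  proof -
    have sums: "(\<lambda>j. real n ^ j / fact j) sums exp (real n)"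
      using exp_converges[of "real n"] by (simp add: divide_real_def mult.commute)
    \<comment> \<open>A single term of the exponential series is at most its sum.\<close>
    have "(\<Sum>j\<in>{n}. real n ^ j / fact j) \<le> (\<Sum>j. real n ^ j / fact j)"
      by (rule sum_le_suminf[OF sums_summable[OF sums]]) auto
    then show ?thesis by (simp add: sums_unique[OF sums])
  qed
  then have "real n ^ n \<le> exp (real n) * fact n" by (simp add: field_simps)
  ultimately have "(real (N choose n) * fact n) * real n ^ n
      \<le> real N ^ n * (exp (real n) * fact n)"
    by (intro mult_mono) auto
  then have "real (N choose n) \<le> (real N / real n) ^ n * exp (real n)"
    using assms by (simp add: field_simps)
  also have "(real N / real n) ^ n = exp (real n * ln (real N / real n))"
    using assms by (simp add: exp_of_nat_mult)
  finally show ?thesis by (simp add: exp_add)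
qed

text \<open>
  The gain \<open>d n l\<close> of the scan over the union bound dominates the logarithm of any fixed power
  of \<open>N = n exp l\<close>.
\<close>

lemma scan_exponent_le:
  fixes d :: real and n N :: nat
  assumes d: "0 < d" and n: "2 \<le> n" "n \<le> N" and l: "14 / d \<le> l"
    and n_large: "2 * (7 + d) / d \<le> real n" and l_def: "l = ln (real N / real n)"
  shows "real n * l + real n - (1 + d) * ((real n - 1) * l) \<le> - 3 * ln (real N + 2)"
proof -
  have "2 * real N \<le> real N * real N" using n by (intro mult_right_mono) auto
  moreover have "2 \<le> real N" using n by simp
  ultimately have "real N + 2 \<le> real N ^ 2" unfolding power2_eq_square by linarith
  then have "ln (real N + 2) \<le> ln (real N ^ 2)" by (intro ln_mono) auto
  also have "\<dots> = 2 * (ln (real n) + l)"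
    using n by (simp add: l_def ln_realpow ln_div)
  also have "ln (real n) \<le> real n" using n by (intro order.trans[OF ln_le_minus_one]) auto
  finally have N: "ln (real N + 2) \<le> 2 * (real n + l)" by simp
  have l0: "0 \<le> l" using l d by (smt (verit) divide_pos_pos)
  \<comment> \<open>Three times the bound on \<open>ln (real N + 2)\<close> costs
    \<open>6 * (n + l)\<close>, so \<open>7 * n + (7 + d) * l \<le> d * n * l\<close> is needed.
    Each hypothesis gives one summand at most half of the right-hand side.\<close>
  have "14 * real n \<le> d * l * real n"
    using l d by (intro mult_right_mono) (auto simp: field_simps)
  moreover have "2 * (7 + d) * l \<le> d * real n * l"
    using n_large d l0 by (intro mult_right_mono) (auto simp: field_simps)
  ultimately have "7 * real n + (7 + d) * l \<le> d * real n * l"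
    by (simp add: algebra_simps)
  then show ?thesis using N by (simp add: algebra_simps)
qed

text \<open>A part \<epsilon> of the exponent \<open>k * H\<close> is reserved for the random
  deviation; the assumption on \<alpha> says that the rest pays for the union bound and the level.
  The type II bound does not depend on \<open>S\<close>, so it survives the maximum.\<close>

lemma calibrated_scan_risk_le:
  fixes p q p' \<epsilon> \<theta> :: real and N n :: nat
  assumes n: "2 \<le> n" "n \<le> N" and p': "0 < p'" "p' \<le> q" and q: "q < 1"
    and p_def: "p = null_prob N n p' q" and \<epsilon>: "0 < \<epsilon>"
  defines "H \<equiv> entropy_fun p q" and "k \<equiv> pairs2 n" and "M \<equiv> pairs2 N"
    and "\<alpha> \<equiv> 1 / (real N + 2) ^ 3"
  assumes H: "0 < H" and \<alpha>: "real (N choose n) * exp (\<epsilon> * k * H - k * H) \<le> \<alpha>"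
  shows "risk N n p' q (calibrated_scan_test N n \<alpha>) \<le> 1 / (real N + 2)
     + 2 / \<epsilon>\<^sup>2 * (72 / (k * H) + 8 / (k * q) + (18 / (M * H) + 1 / (M * p)) / (1 - p)\<^sup>2)"
proof -
  have k: "0 < k" and M: "0 < M" and kM: "k \<le> M"
    using n by (auto simp: k_def M_def pairs2_def intro!: divide_right_mono mult_mono)
  have "p = p' + (q - p') * (k / M)" by (simp add: p_def null_prob_def k_def M_def)
  moreover have "(q - p') * (k / M) \<le> q - p'"
    by (rule mult_left_le) (use k M kM p' in auto)
  moreover have "0 \<le> (q - p') * (k / M)" using k M p' by simp
  ultimately have pq: "0 < p" "p \<le> q" "p < 1" using p' q by linarith+
  have "measure_pmf.prob (null_law N n p' q) {W. calibrated_scan_test N n \<alpha> W = 1}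
      \<le> (M + 1) * \<alpha>"
    using calibrated_scan_size[OF pq(1,3), of \<alpha> N n] card_upper_pairs[of "{1..N}"]
    by (simp add: null_law_def p_def M_def \<alpha>_def)
  \<comment> \<open>The cubic level leaves one factor to spare after the \<open>M + 1\<close>
    possible edge counts.\<close>
  also have "\<dots> \<le> (real N + 2) ^ 2 * \<alpha>"
    by (intro mult_right_mono) (auto simp: M_def pairs2_def \<alpha>_def power2_eq_square algebra_simps)
  also have "\<dots> = 1 / (real N + 2)"
    by (simp add: \<alpha>_def power2_eq_square power3_eq_cube)
  finally have size: "measure_pmf.prob (null_law N n p' q)
      {W. calibrated_scan_test N n \<alpha> W = 1} \<le> 1 / (real N + 2)" .
  let ?B = "2 / \<epsilon>\<^sup>2 * (72 / (k * H) + 8 / (k * q) + (18 / (M * H) + 1 / (M * p)) / (1 - p)\<^sup>2)"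
  have power: "measure_pmf.prob (alt_law N S p' q) {W. calibrated_scan_test N n \<alpha> W = 0} \<le> ?B"
    if S: "S \<in> node_subsets N n" for S
  proof -
    have t: "0 < \<epsilon> * k * H" using \<epsilon> k H by simp
    note calibrated_scan_type_II[OF n p' q S p_def t, folded H_def k_def M_def, OF \<alpha>]
    also note type_II_bound_le[OF pq(1,2) q k M \<epsilon>, folded H_def, OF H]
    finally show ?thesis .
  qed
  have "Max ((\<lambda>S. measure_pmf.prob (alt_law N S p' q)
      {W. calibrated_scan_test N n \<alpha> W = 0}) ` node_subsets N n) \<le> ?B"
    using node_subsets_nonempty[OF n(2)] power by (subst Max_le_iff) auto
  with size show ?thesis unfolding risk_def by linarith
qed

section \<open>Passage to the limit\<close>

lemma risk_nonneg:
  assumes "n \<le> N"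
  shows "0 \<le> risk N n p' q T"
proof -
  let ?V = "(\<lambda>S. measure_pmf.prob (alt_law N S p' q) {W. T W = 0}) ` node_subsets N n"
  have "Max ?V \<in> ?V" using node_subsets_nonempty[OF assms] by (intro Max_in) auto
  then have "0 \<le> Max ?V" by auto
  then show ?thesis by (simp add: risk_def)
qed

theorem proposition5:
  fixes n :: "nat \<Rightarrow> nat" and p0' p1 p0 :: "nat \<Rightarrow> real"
  assumes probs: "\<And>N. 0 < p0' N \<and> p0' N \<le> p1 N \<and> p1 N < 1"
    and p0: "\<And>N. p0 N = null_prob N (n N) (p0' N) (p1 N)"
    and n_small: "(\<lambda>N. real (n N) / real N) \<longlonglongrightarrow> 0"
    and p0_away: "\<exists>c<1. \<forall>\<^sub>F N in sequentially. p0 N \<le> c"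
    and N2p0: "filterlim (\<lambda>N. (real N)\<^sup>2 * p0 N) at_top sequentially"
    and n_top: "filterlim n at_top sequentially"
    and n2p1: "filterlim (\<lambda>N. (real (n N))\<^sup>2 * p1 N) at_top sequentially"
    and liminf_p0: "liminf (\<lambda>N. ereal (p0 N * (real N)\<^sup>2 / real (n N))) > 1"
    and liminf_H: "liminf (\<lambda>N. ereal (real (n N) * entropy_fun (p0 N) (p1 N)
                      / (2 * ln (real N / real (n N))))) > 1"
  shows "\<exists>\<alpha> :: nat \<Rightarrow> real. (\<forall>N. 0 < \<alpha> N \<and> \<alpha> N < 1) \<and>
           (\<lambda>N. risk N (n N) (p0' N) (p1 N) (calibrated_scan_test N (n N) (\<alpha> N)))
             \<longlonglongrightarrow> 0"
proof -
  define H where "H N = entropy_fun (p0 N) (p1 N)" for N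
  define k where "k N = pairs2 (n N)" for N
  define M where "M N = pairs2 N" for N
  define l where "l N = ln (real N / real (n N))" for N
  define \<alpha> where "\<alpha> N = 1 / (real N + 2) ^ 3" for N
  obtain c where c: "c < 1" "\<forall>\<^sub>F N in sequentially. p0 N \<le> c" using p0_away by blast
  obtain \<rho> where \<rho>: "1 < ereal \<rho>"
    and "ereal \<rho> < liminf (\<lambda>N. ereal (real (n N) * H N / (2 * l N)))"
    using ereal_dense2[OF liminf_H] unfolding H_def l_def by blast
  then have ev_H: "\<forall>\<^sub>F N in sequentially. \<rho> < real (n N) * H N / (2 * l N)"
    by (auto dest!: less_LiminfD)
  have \<rho>: "1 < \<rho>" using \<rho> by simp
  \<comment> \<open>The margin \<open>\<rho> - 1\<close> is split in two: one half becomes the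
    deviation allowance \<epsilon>, the other the gain \<open>d\<close> over the union bound,
    through \<open>(1 - \<epsilon>) * \<rho> = 1 + d\<close>.\<close>
  define \<epsilon> where "\<epsilon> = (\<rho> - 1) / (2 * \<rho>)"
  define d where "d = (\<rho> - 1) / 2"
  have \<epsilon>: "0 < \<epsilon>" "\<epsilon> < 1" "(1 - \<epsilon>) * \<rho> = 1 + d" and d: "0 < d"
    using \<rho> by (auto simp: \<epsilon>_def d_def field_simps)
  have nR: "filterlim (\<lambda>N. real (n N)) at_top sequentially"
    using n_top by (rule filterlim_compose[OF filterlim_real_sequentially])
  have ev_n: "\<forall>\<^sub>F N in sequentially. C \<le> real (n N)" for C
    using nR by (simp add: filterlim_at_top)
  have ev_nN: "\<forall>\<^sub>F N in sequentially. real (n N) / real N < C" if "0 < C" for C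
    using order_tendstoD(2)[OF n_small that] .
  have ev_l: "\<forall>\<^sub>F N in sequentially. C \<le> l N" for C
    using ev_nN[OF exp_gt_zero[of "- C"]] ev_n[of 1] eventually_gt_at_top[of 0]
  proof eventually_elim
    case (elim N)
    then have "exp C \<le> real N / real (n N)" by (simp add: exp_minus field_simps)
    then show ?case using elim by (simp add: l_def ln_ge_iff)
  qed
  have ev: "\<forall>\<^sub>F N in sequentially. 2 \<le> n N \<and> n N \<le> N \<and> 14 / d \<le> l N \<and> 1 \<le> l N
      \<and> 2 * (7 + d) / d \<le> real (n N) \<and> \<rho> < real (n N) * H N / (2 * l N) \<and> p0 N \<le> c"
    using ev_n[of 2] ev_n[of "2 * (7 + d) / d"] ev_nN[OF zero_less_one] ev_l[of 1]
      ev_l[of "14 / d"] ev_H c(2) eventually_gt_at_top[of 0]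
    by eventually_elim (auto simp: field_simps)
  have kH: "\<forall>\<^sub>F N in sequentially. 0 < k N \<and> k N \<le> M N \<and> 0 < H N
      \<and> \<rho> * ((real (n N) - 1) * l N) \<le> k N * H N \<and> (real (n N))\<^sup>2 / 4 \<le> k N
      \<and> (real N)\<^sup>2 / 4 \<le> M N \<and> 0 < p0 N"
    using ev
  proof eventually_elim
    case (elim N)
    have h: "\<rho> * (2 * l N) < real (n N) * H N"
      using elim by (subst pos_less_divide_eq[symmetric]) auto
    then have "0 < real (n N) * H N" using elim \<rho> by (smt (verit) mult_pos_pos)
    then have H: "0 < H N" using elim by (simp add: zero_less_mult_iff)
    \<comment> \<open>Multiplying by \<open>(n - 1) / 2\<close> turns \<open>n * H\<close> into
      \<open>k * H\<close>, since \<open>k = n * (n - 1) / 2\<close>.\<close>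
    have "(real (n N) - 1) / 2 * (\<rho> * (2 * l N)) \<le> (real (n N) - 1) / 2 * (real (n N) * H N)"
      using h elim by (intro mult_left_mono) auto
    moreover have "(real (n N) - 1) / 2 * (\<rho> * (2 * l N)) = \<rho> * ((real (n N) - 1) * l N)"
      by simp
    moreover have "(real (n N) - 1) / 2 * (real (n N) * H N) = k N * H N"
      by (simp add: k_def pairs2_def)
    ultimately have 1: "\<rho> * ((real (n N) - 1) * l N) \<le> k N * H N" by linarith
    \<comment> \<open>This transfers the divergence of \<open>n^2 * p1\<close> and
      \<open>N^2 * p0\<close> to \<open>k * p1\<close> and \<open>M * p0\<close>.\<close>
    have 2: "real m ^ 2 / 4 \<le> pairs2 m" if "2 \<le> m" for m
    proof -
      have "0 \<le> real m * (real m - 2)" using that by simp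
      then show ?thesis by (simp add: pairs2_def power2_eq_square algebra_simps)
    qed
    have k: "0 < k N" "k N \<le> M N"
      using elim by (auto simp: k_def M_def pairs2_def intro!: divide_right_mono mult_mono)
    have "p0 N = p0' N + (p1 N - p0' N) * (k N / M N)"
      by (simp add: p0 null_prob_def k_def M_def)
    then have "0 < p0 N"
      using probs[of N] k by (auto intro!: add_pos_nonneg)
    with H 1 k 2[of "n N"] 2[of N] elim show ?case by (simp add: k_def M_def)
  qed
  have kH_top: "filterlim (\<lambda>N. k N * H N) at_top sequentially"
  proof (rule filterlim_at_top_mono)
    show "filterlim (\<lambda>N. real (n N) - 1) at_top sequentially"
      using filterlim_tendsto_add_at_top[OF tendsto_const[of "- 1"] nR] by simp
    show "\<forall>\<^sub>F N in sequentially. real (n N) - 1 \<le> k N * H N"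
      using kH ev
    proof eventually_elim
      case (elim N)
      have "1 * ((real (n N) - 1) * 1) \<le> \<rho> * ((real (n N) - 1) * l N)"
        using elim \<rho> by (intro mult_mono) auto
      also have "\<dots> \<le> k N * H N" using elim by blast
      finally show ?case by simp
    qed
  qed
  have MH_top: "filterlim (\<lambda>N. M N * H N) at_top sequentially"
    by (rule filterlim_at_top_mono[OF kH_top])
      (use kH in \<open>auto elim!: eventually_mono intro!: mult_right_mono\<close>)
  have kq_top: "filterlim (\<lambda>N. k N * p1 N) at_top sequentially"
  proof (rule filterlim_at_top_mono)
    show "filterlim (\<lambda>N. 1 / 4 * ((real (n N))\<^sup>2 * p1 N)) at_top sequentially"
      by (rule filterlim_tendsto_pos_mult_at_top[OF tendsto_const _ n2p1]) simp
    show "\<forall>\<^sub>F N in sequentially. 1 / 4 * ((real (n N))\<^sup>2 * p1 N) \<le> k N * p1 N"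
      using kH
    proof eventually_elim
      case (elim N)
      have "(real (n N))\<^sup>2 / 4 * p1 N \<le> k N * p1 N"
        using elim probs[of N] by (intro mult_right_mono) auto
      then show ?case by simp
    qed
  qed
  have Mp_top: "filterlim (\<lambda>N. M N * p0 N) at_top sequentially"
  proof (rule filterlim_at_top_mono)
    show "filterlim (\<lambda>N. 1 / 4 * ((real N)\<^sup>2 * p0 N)) at_top sequentially"
      by (rule filterlim_tendsto_pos_mult_at_top[OF tendsto_const _ N2p0]) simp
    show "\<forall>\<^sub>F N in sequentially. 1 / 4 * ((real N)\<^sup>2 * p0 N) \<le> M N * p0 N"
      using kH
    proof eventually_elim
      case (elim N)
      have "(real N)\<^sup>2 / 4 * p0 N \<le> M N * p0 N"
        using elim by (intro mult_right_mono) auto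
      then show ?case by simp
    qed
  qed
  \<comment> \<open>Replacing \<open>p0 N\<close> by the uniform bound \<open>c < 1\<close> makes
    the last denominator constant in \<open>N\<close>.\<close>
  define B where "B N = 1 / (real N + 2) + 2 / \<epsilon>\<^sup>2 * (72 / (k N * H N) + 8 / (k N * p1 N)
      + (18 / (M N * H N) + 1 / (M N * p0 N)) / (1 - c)\<^sup>2)" for N
  have inv: "(\<lambda>N. a / f N) \<longlonglongrightarrow> 0" if "filterlim f at_top sequentially"
    for a :: real and f :: "nat \<Rightarrow> real"
    by (rule tendsto_divide_0[OF tendsto_const]) (rule filterlim_at_top_imp_at_infinity[OF that])
  have N2: "filterlim (\<lambda>N. real N + 2) at_top sequentially"
    using filterlim_tendsto_add_at_top[OF tendsto_const[of 2] filterlim_real_sequentially]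
    by (simp add: add.commute)
  have "B \<longlonglongrightarrow> 0 + 2 / \<epsilon>\<^sup>2 * (0 + 0 + (0 + 0) / (1 - c)\<^sup>2)"
    unfolding B_def
    by (intro tendsto_add tendsto_mult_left tendsto_divide tendsto_const
        inv N2 kH_top kq_top MH_top Mp_top) (use c in auto)
  then have B0: "B \<longlonglongrightarrow> 0" by simp
  have ub: "\<forall>\<^sub>F N in sequentially.
      risk N (n N) (p0' N) (p1 N) (calibrated_scan_test N (n N) (\<alpha> N)) \<le> B N"
    using ev kH
  proof eventually_elim
    case (elim N)
    \<comment> \<open>The union bound costs about \<open>n * l\<close>, while the available exponent
      is at least \<open>(1 + d) * (n - 1) * l\<close>; the surplus reaches the cubic level.\<close>
    have "real (N choose n N) * exp (\<epsilon> * k N * H N - k N * H N)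
        \<le> exp (real (n N) * l N + real (n N)) * exp (- ((1 + d) * ((real (n N) - 1) * l N)))"
    proof (rule mult_mono)
      show "real (N choose n N) \<le> exp (real (n N) * l N + real (n N))"
        unfolding l_def using elim by (intro choose_le_exp) auto
      have "(1 - \<epsilon>) * (\<rho> * ((real (n N) - 1) * l N)) \<le> (1 - \<epsilon>) * (k N * H N)"
        using elim \<epsilon> by (intro mult_left_mono) auto
      then have "(1 + d) * ((real (n N) - 1) * l N) \<le> (1 - \<epsilon>) * (k N * H N)"
        by (simp only: mult.assoc[symmetric] \<epsilon>(3))
      then show "exp (\<epsilon> * k N * H N - k N * H N) \<le> exp (- ((1 + d) * ((real (n N) - 1) * l N)))"
        by (simp add: algebra_simps)
    qed auto
    also have "\<dots> = exp (real (n N) * l N + real (n N) - (1 + d) * ((real (n N) - 1) * l N))"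
      by (simp flip: exp_add)
    also have "\<dots> \<le> exp (- 3 * ln (real N + 2))"
      using scan_exponent_le[OF d, of "n N" N "l N"] elim by (simp add: l_def)
    also have "\<dots> = \<alpha> N"
      by (simp add: \<alpha>_def exp_minus exp_of_nat_mult[of 3, simplified] divide_inverse)
    finally have lev: "real (N choose n N) * exp (\<epsilon> * k N * H N - k N * H N) \<le> \<alpha> N" .
    have "risk N (n N) (p0' N) (p1 N) (calibrated_scan_test N (n N) (\<alpha> N)) \<le> 1 / (real N + 2)
        + 2 / \<epsilon>\<^sup>2 * (72 / (k N * H N) + 8 / (k N * p1 N)
          + (18 / (M N * H N) + 1 / (M N * p0 N)) / (1 - p0 N)\<^sup>2)"
      unfolding \<alpha>_def k_def M_def H_def
      by (rule calibrated_scan_risk_le)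
        (use elim probs[of N] p0[of N] \<epsilon> lev in \<open>auto simp: \<alpha>_def k_def H_def\<close>)
    also have "\<dots> \<le> B N"
      unfolding B_def
      using elim c(1)
      by (intro add_left_mono mult_left_mono divide_left_mono power_mono mult_pos_pos
          add_nonneg_nonneg) auto
    finally show ?case .
  qed
  have lb: "\<forall>\<^sub>F N in sequentially.
      0 \<le> risk N (n N) (p0' N) (p1 N) (calibrated_scan_test N (n N) (\<alpha> N))"
    using ev by eventually_elim (auto intro: risk_nonneg)
  have "(\<lambda>N. risk N (n N) (p0' N) (p1 N) (calibrated_scan_test N (n N) (\<alpha> N))) \<longlonglongrightarrow> 0"
    by (rule tendsto_sandwich[OF lb ub tendsto_const B0])
  moreover have "0 < \<alpha> N \<and> \<alpha> N < 1" for N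
    by (simp add: \<alpha>_def one_less_power)
  ultimately show ?thesis by blast
qed

end
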